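(* Let $X$ be an Asplund space, $Y=\mathbb{R}^d$, $P:X\to Y$ continuous, $\Lambda\subset Y$ closed, $P(\bar{x})\in\Lambda$. Suppose that $P$ is Hadamard directionally differentiable at $\bar{x}$ in a given direction $u\in X$. If directional quasi-normality holds at $\bar{x}$ in the direction $u$, then the set-valued mapping $G(x):=P(x)-\Lambda$ is metrically subregular at $(\bar{x},0)$ in the direction $u$.
   Context: Notation: $\mathbb{B}$ is a closed unit ball, $\operatorname{dist}(x,\Omega)=\inf_{z\in\Omega}\|x-z\|$ with $\operatorname{dist}(x,\emptyset)=+\infty$, $\xrightarrow{w^*}$ is weak$^*$ convergence, $\operatorname{gph}F$ is the graph, $[y]_i$ is the $i$-th coordinate of $y\in\mathbb{R}^d$, and $Y^*$ is identified with $\mathbb{R}^d$. Cones. For a Banach space $Z$, $\Omega\subset Z$ and $\bar z\in\Omega$: - Contingent cone: $T(\bar z;\Omega)=\{w\in Z\mid\exists\,t_k\downarrow0,\ z_k\in\Omega:\ (z_k-\bar z)/t_k\to w\}$. - $\varepsilon$-normals ($\varepsilon\ge0$): $\widehat N_\varepsilon(\bar z;\Omega)=\{z^*\in Z^*\mid\limsup_{z\to\bar z,\ z\in\Omega,\ z\ne\bar z}\langle z^*,z-\bar z\rangle/\|z-\bar z\|\le\varepsilon\}$ (all of $Z^*$ if $\Omega=\{\bar z\}$; $\emptyset$ at points outside $\Omega$); Fréchet normal cone $\widehat N:=\widehat N_0$. - Directional limiting normal cone in direction $w\in Z$: $z^*\in N(\bar z;\Omega;w)$ iff there are $\varepsilon_k\downarrow0$,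 $t_k\downarrow0$, $w_k\to w$, $z_k^*\xrightarrow{w^*}z^*$ with $\bar z+t_kw_k\in\Omega$ and $z_k^*\in\widehat N_{\varepsilon_k}(\bar z+t_kw_k;\Omega)$ for all $k$. Graphical derivative: $v\in DP(\bar x)(u)$ iff $(u,v)\in T((\bar x,P(\bar x));\operatorname{gph}P)$. Directional coderivative: $D_N^*P(\bar x;(u,v))(y^* )=\{x^*\in X^*\mid(x^*,-y^* )\in N((\bar x,P(\bar x));\operatorname{gph}P;(u,v))\}$. Hadamard directional derivative: $P'_H(\bar x;u)=\lim_{t\downarrow0,\,u'\to u}(P(\bar x+tu')-P(\bar x))/t$; $P$ is Hadamard directionally differentiable at $\bar x$ in direction $u$ if this limit exists. Directional quasi-normality at $\bar x$ in direction $u$ (for $P(\bar x)\in\Lambda$, $Y=\mathbb{R}^d$): for every $v\in DP(\bar x)(u)\cap T(P(\bar x);\Lambda)$ there is no $y^*\in Y^*\setminus\{0\}$ such that simultaneously (i) $0\in D_N^*P(\bar x;(u,v))(y^* )$ and $y^*\in N(P(\bar x);\Lambda;v)$; (ii) there exist $t_k\downarrow0$, $u_k\to u$, $s_k\to P(\bar x)$, $y_k^*\to y^*$ with $y_k^*\in\widehat N(s_k;\Lambda)$; (iii) for these sequences and all sufficiently large $k$, $[y^*]_i\,[P(\bar x+t_ku_k)-s_k]_i>0$ for every $i\in\{1,\dots,d\}$ with $[y^*]_i\ne0$. Directional metric subregularity: with $\mathcal V_{\varepsilon,\delta}(\bar x;d)=\bar x+\{z\in\varepsilon\mathbb B\mid\big\|\|d\|z-\|z\|d\big\|\le\delta\|z\|\|d\|\}$,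 a mapping $F:X\rightrightarrows Y$ is metrically subregular at $(\bar x,\bar y)\in\operatorname{gph}F$ in direction $u$ if there are $\varepsilon,\delta,\kappa>0$ with $\operatorname{dist}(x,F^{-1}(\bar y))\le\kappa\operatorname{dist}(\bar y,F(x))$ for all $x\in\mathcal V_{\varepsilon,\delta}(\bar x;u)$. *)

theory Defs
  imports "HOL-Analysis.Analysis"
begin

text \<open>
  The dual of a normed space \<open>'z\<close> is \<open>'z \<Rightarrow>\<^sub>L real\<close>.  The space \<open>\<real>\<^sup>d\<close> is \<open>real ^ 'd\<close>, and a vector
  \<open>y\<close> of it is identified with the functional \<open>blinfun_inner_right y\<close>, that is
  \<open>\<lambda>x. y \<bullet> x\<close>.  The product \<open>'x \<times> real ^ 'd\<close> carries the library norm
  \<open>\<lambda>(x, y). sqrt (norm x ^ 2 + norm y ^ 2)\<close>; the cones and coderivatives below do not depend on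
  the choice among the usual equivalent product norms.
\<close>

text \<open>Library differentiability at a point is Frechet differentiability.\<close>

definition asplund_space :: "'x::banach itself \<Rightarrow> bool" where
  "asplund_space _ \<longleftrightarrow>
     (\<forall>(U::'x set) (f::'x \<Rightarrow> real).
        open U \<and> convex U \<and> convex_on U f \<and> continuous_on U f \<longrightarrow>
        U \<subseteq> closure {x \<in> U. f differentiable (at x)})"

text \<open>
  The usual reading of \<open>t\<^sub>k \<down> 0\<close>: positive and convergent to \<open>0\<close>, not necessarily monotone.
\<close>

definition decreases_to_zero :: "(nat \<Rightarrow> real) \<Rightarrow> bool" where
  "decreases_to_zero t \<longleftrightarrow> (\<forall>k. t k > 0) \<and> t \<longlonglongrightarrow> 0"

definition contingent_cone :: "'z::real_normed_vector \<Rightarrow> 'z set \<Rightarrow> 'z set" where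
  "contingent_cone z \<Omega> =
     {w. \<exists>t zs. decreases_to_zero t \<and> (\<forall>k. zs k \<in> \<Omega>) \<and>
           (\<lambda>k. (zs k - z) /\<^sub>R t k) \<longlonglongrightarrow> w}"

text \<open>
  If \<open>z\<close> is an isolated point of \<open>\<Omega>\<close>, the filter \<open>at z within \<Omega>\<close> is trivial and
  the upper limit is \<open>-\<infinity>\<close>, so that the set of normals is the whole dual.
\<close>

definition eps_normals ::
    "real \<Rightarrow> 'z::real_normed_vector \<Rightarrow> 'z set \<Rightarrow> ('z \<Rightarrow>\<^sub>L real) set" where
  "eps_normals \<epsilon> z \<Omega> =
     {zd. z \<in> \<Omega> \<and>
          Limsup (at z within \<Omega>)
            (\<lambda>x. ereal (blinfun_apply zd (x - z) / norm (x - z))) \<le> ereal \<epsilon>}"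

definition frechet_normal_cone ::
    "'z::real_normed_vector \<Rightarrow> 'z set \<Rightarrow> ('z \<Rightarrow>\<^sub>L real) set" where
  "frechet_normal_cone z \<Omega> = eps_normals 0 z \<Omega>"

text \<open>
  For real-valued functionals the strong operator topology is the topology of pointwise
  convergence, i.e. the weak* topology of the dual.
\<close>

definition dir_limiting_normal_cone ::
    "'z::real_normed_vector \<Rightarrow> 'z set \<Rightarrow> 'z \<Rightarrow> ('z \<Rightarrow>\<^sub>L real) set" where
  "dir_limiting_normal_cone z \<Omega> w =
     {zd. \<exists>\<epsilon> t ws zds.
        decreases_to_zero \<epsilon> \<and> decreases_to_zero t \<and> ws \<longlonglongrightarrow> w \<and>
        limitin strong_operator_topology zds zd sequentially \<and>
        (\<forall>k. z + t k *\<^sub>R ws k \<in> \<Omega> \<and>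
             zds k \<in> eps_normals (\<epsilon> k) (z + t k *\<^sub>R ws k) \<Omega>)}"

definition gph :: "('x \<Rightarrow> 'y) \<Rightarrow> ('x \<times> 'y) set" where
  "gph P = {(x, y). y = P x}"

definition graphical_derivative ::
    "('x::real_normed_vector \<Rightarrow> 'y::real_normed_vector) \<Rightarrow> 'x \<Rightarrow> 'x \<Rightarrow> 'y set" where
  "graphical_derivative P x u = {v. (u, v) \<in> contingent_cone (x, P x) (gph P)}"

definition dual_pair ::
    "('x::real_normed_vector \<Rightarrow>\<^sub>L real) \<Rightarrow> ('y::real_normed_vector \<Rightarrow>\<^sub>L real) \<Rightarrow>
     ('x \<times> 'y) \<Rightarrow>\<^sub>L real" where
  "dual_pair xd yd = (xd o\<^sub>L fst_blinfun) + (yd o\<^sub>L snd_blinfun)"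

definition dir_coderivative ::
    "('x::real_normed_vector \<Rightarrow> 'y::real_normed_vector) \<Rightarrow> 'x \<Rightarrow> 'x \<times> 'y \<Rightarrow>
     ('y \<Rightarrow>\<^sub>L real) \<Rightarrow> ('x \<Rightarrow>\<^sub>L real) set" where
  "dir_coderivative P x w yd =
     {xd. dual_pair xd (- yd) \<in> dir_limiting_normal_cone (x, P x) (gph P) w}"

definition hadamard_dir_differentiable ::
    "('x::real_normed_vector \<Rightarrow> 'y::real_normed_vector) \<Rightarrow> 'x \<Rightarrow> 'x \<Rightarrow> bool" where
  "hadamard_dir_differentiable P x u \<longleftrightarrow>
     (\<exists>l. ((\<lambda>(t, u'). (P (x + t *\<^sub>R u') - P x) /\<^sub>R t) \<longlongrightarrow> l)
            (at_right 0 \<times>\<^sub>F nhds u))"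

definition dir_quasi_normality ::
    "('x::real_normed_vector \<Rightarrow> real ^ 'd) \<Rightarrow> (real ^ 'd) set \<Rightarrow> 'x \<Rightarrow> 'x \<Rightarrow> bool" where
  "dir_quasi_normality P \<Lambda> x u \<longleftrightarrow>
     (\<forall>v \<in> graphical_derivative P x u \<inter> contingent_cone (P x) \<Lambda>.
        \<not> (\<exists>y. y \<noteq> 0 \<and>
              0 \<in> dir_coderivative P x (u, v) (blinfun_inner_right y) \<and>
              blinfun_inner_right y \<in> dir_limiting_normal_cone (P x) \<Lambda> v \<and>
              (\<exists>t us s ys.
                 decreases_to_zero t \<and> us \<longlonglongrightarrow> u \<and> s \<longlonglongrightarrow> P x \<and> ys \<longlonglongrightarrow> y \<and>
                 (\<forall>k. blinfun_inner_right (ys k) \<in> frechet_normal_cone (s k) \<Lambda>) \<and>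
                 (\<forall>\<^sub>F k in sequentially.
                    \<forall>i. y $ i \<noteq> 0 \<longrightarrow> y $ i * (P (x + t k *\<^sub>R us k) - s k) $ i > 0))))"

text \<open>
  Unlike \<^const>\<open>infdist\<close>, the distance to the empty set is \<open>\<infinity>\<close>.
\<close>

definition set_dist :: "'z::real_normed_vector \<Rightarrow> 'z set \<Rightarrow> ereal" where
  "set_dist x \<Omega> = (INF z\<in>\<Omega>. ereal (norm (x - z)))"

definition dir_nbhd :: "real \<Rightarrow> real \<Rightarrow> 'x::real_normed_vector \<Rightarrow> 'x \<Rightarrow> 'x set" where
  "dir_nbhd \<epsilon> \<delta> x d =
     (+) x ` {z \<in> cball 0 \<epsilon>. norm (norm d *\<^sub>R z - norm z *\<^sub>R d) \<le> \<delta> * norm z * norm d}"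

definition dir_metrically_subregular ::
    "('x::real_normed_vector \<Rightarrow> 'y::real_normed_vector set) \<Rightarrow> 'x \<Rightarrow> 'y \<Rightarrow> 'x \<Rightarrow> bool" where
  "dir_metrically_subregular F x0 y0 u \<longleftrightarrow>
     y0 \<in> F x0 \<and>
     (\<exists>\<epsilon>>0. \<exists>\<delta>>0. \<exists>\<kappa>>0. \<forall>x \<in> dir_nbhd \<epsilon> \<delta> x0 u.
        set_dist x {x'. y0 \<in> F x'} \<le> ereal \<kappa> * set_dist y0 (F x))"

end

theory Submission
  imports Defs
begin

text \<open>
  If subregularity fails, there are \<open>x\<^sub>k \<rightarrow> xbar\<close> from direction \<open>u\<close> at which
  \<open>dist (P x\<^sub>k) \<Lambda>\<close> is much smaller than both the distance from \<open>x\<^sub>k\<close> to the solution set and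
  \<open>\<parallel>x\<^sub>k - xbar\<parallel>\<close>.  Ekeland's principle for the function \<open>x \<mapsto> dist (P x) \<Lambda>\<close> moves \<open>x\<^sub>k\<close>,
  negligibly, to a point that is still infeasible and minimises a slightly perturbed function.
  Let \<open>s\<^sub>k\<close> be a projection of \<open>P x\<^sub>k\<close> onto \<open>\<Lambda>\<close> and \<open>y\<^sub>k\<close> the unit vector pointing
  from \<open>s\<^sub>k\<close> to \<open>P x\<^sub>k\<close>.  Then \<open>y\<^sub>k\<close> is a proximal, hence Frechet, normal to \<open>\<Lambda>\<close> at \<open>s\<^sub>k\<close>,
  and minimality makes \<open>(0, -y\<^sub>k)\<close> an \<open>\<epsilon>\<^sub>k\<close>-normal to the graph of \<open>P\<close>.  Every cluster point
  of \<open>y\<^sub>k\<close> violates quasi-normality.  Since \<open>\<epsilon>\<close>-normals are admitted in the limiting cones, no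
  fuzzy sum rule is needed.
\<close>

section \<open>Ekeland's variational principle\<close>

text \<open>Reading \<open>z \<in> S x\<close> below as "\<open>z\<close> lies under
  \<open>x\<close>" gives a reflexive and transitive relation. Repeatedly choosing an almost minimal
  point under the current one shrinks the sets \<open>S (X n)\<close> to one point, and no other
  point lies under that one.\<close>

lemma ekeland_variational_principle:
  fixes f :: "'a::complete_space \<Rightarrow> real"
  assumes cont: "continuous_on UNIV f" and bdd: "bdd_below (range f)" and c: "c > 0"
  obtains x where "f x + c * dist x0 x \<le> f x0" "\<And>z. z \<noteq> x \<Longrightarrow> f x < f z + c * dist x z"
proof -
  define S where "S x = {z. f z + c * dist x z \<le> f x}" for x
  have self: "x \<in> S x" for x
    by (simp add: S_def)
  have trans: "S z \<subseteq> S x" if "z \<in> S x" for x z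
  proof
    fix w assume "w \<in> S z"
    moreover have "c * dist x w \<le> c * dist x z + c * dist z w"
      using c dist_triangle[of x w z] by (simp flip: distrib_left)
    ultimately show "w \<in> S x"
      using that by (simp add: S_def)
  qed
  have closed: "closed (S x)" for x
    unfolding S_def by (intro closed_Collect_le continuous_intros cont)
  have step: "\<exists>y. y \<in> S x \<and> (\<forall>z\<in>S x. f y \<le> f z + (1/2)^n)" for x and n :: nat
  proof -
    have bdd': "bdd_below (f ` S x)"
      using bdd by (rule bdd_below_mono) auto
    have "Inf (f ` S x) < Inf (f ` S x) + (1/2)^n"
      by simp
    then obtain y where y: "y \<in> S x" "f y < Inf (f ` S x) + (1/2)^n"
      using self[of x] bdd' by (subst (asm) cInf_less_iff) auto
    have "f y \<le> f z + (1/2)^n" if "z \<in> S x" for z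
      using cInf_lower[OF imageI[OF that] bdd'] y(2) by linarith
    with y(1) show ?thesis by blast
  qed
  have "\<exists>X. \<forall>n. (n = 0 \<longrightarrow> X n = x0) \<and>
      X (Suc n) \<in> S (X n) \<and> (\<forall>z\<in>S (X n). f (X (Suc n)) \<le> f z + (1/2)^n)"
    by (rule dependent_nat_choice) (use step in auto)
  then obtain X where "\<forall>n. (n = 0 \<longrightarrow> X n = x0) \<and>
      X (Suc n) \<in> S (X n) \<and> (\<forall>z\<in>S (X n). f (X (Suc n)) \<le> f z + (1/2)^n)" ..
  then have X: "X 0 = x0" "\<And>n. X (Suc n) \<in> S (X n)"
      "\<And>n z. z \<in> S (X n) \<Longrightarrow> f (X (Suc n)) \<le> f z + (1/2)^n"
    by simp_all
  have anti: "S (X n) \<subseteq> S (X m)" if "m \<le> n" for m n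
    using that by (rule lift_Suc_antimono_le[of "\<lambda>n. S (X n)", rotated]) (intro trans X)
  \<comment> \<open>Near minimality over \<open>S (X n)\<close> bounds
    \<open>f (X (Suc n)) - f z\<close> above by \<open>(1/2)^n\<close>; membership in
    \<open>S (X (Suc n))\<close> bounds it below by \<open>c\<close> times the distance.\<close>
  have radius: "dist (X (Suc n)) z \<le> (1/2)^n / c" if "z \<in> S (X (Suc n))" for n z
  proof -
    have "z \<in> S (X n)"
      using that anti[of n "Suc n"] by auto
    from X(3)[OF this] that have "dist (X (Suc n)) z * c \<le> (1/2)^n"
      unfolding S_def mem_Collect_eq by (simp only: mult.commute)
    with c show ?thesis
      by (simp only: pos_le_divide_eq)
  qed
  have small: "\<exists>n. \<forall>x\<in>S (X n). \<forall>y\<in>S (X n). dist x y < e" if e: "e > 0" for e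
  proof -
    obtain n where n: "(1/2::real)^n < c * e / 2"
      using real_arch_pow_inv[of "c * e / 2" "1/2"] c e by auto
    have "dist x y < e" if "x \<in> S (X (Suc n))" "y \<in> S (X (Suc n))" for x y
    proof -
      have "(1/2)^n / c < e / 2"
        using n c by (simp add: field_simps)
      then show ?thesis
        using radius[OF that(1)] radius[OF that(2)] dist_triangle3[of x y "X (Suc n)"] by linarith
    qed
    then show ?thesis by blast
  qed
  \<comment> \<open>Cantor's intersection theorem; completeness enters here.\<close>
  obtain a where a: "\<Inter>(range (\<lambda>n. S (X n))) = {a}"
    using decreasing_closed_nest_sing[of "\<lambda>n. S (X n)"] closed self anti small by blast
  have aS: "a \<in> S (X n)" for n
    using a by blast
  have "f a < f z + c * dist a z" if "z \<noteq> a" for z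
  proof (rule ccontr)
    assume "\<not> ?thesis"
    then have "z \<in> S a"
      by (simp add: S_def)
    then have "z \<in> \<Inter>(range (\<lambda>n. S (X n)))"
      using trans aS by blast
    with a that show False by simp
  qed
  moreover have "f a + c * dist x0 a \<le> f x0"
    using aS[of 0] X(1) by (simp add: S_def)
  ultimately show thesis
    using that by blast
qed

section \<open>Normals from quadratic bounds, projections and minimality\<close>

text \<open>After division by \<open>norm (x - z)\<close> the bound is
  \<open>\<epsilon> + K * norm (x - z)\<close>, which tends to \<open>\<epsilon>\<close>: a
  quadratic error does not affect normality.\<close>

lemma proximal_imp_eps_normals:
  assumes "z \<in> \<Omega>"
    and prox: "\<And>x. x \<in> \<Omega> \<Longrightarrow>
      blinfun_apply zd (x - z) \<le> \<epsilon> * norm (x - z) + K * (norm (x - z))\<^sup>2"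
  shows "zd \<in> eps_normals \<epsilon> z \<Omega>"
proof -
  have "\<forall>\<^sub>F x in at z within \<Omega>. ereal (blinfun_apply zd (x - z) / norm (x - z)) < y"
    if "ereal \<epsilon> < y" for y
  proof -
    have "((\<lambda>x. ereal (\<epsilon> + K * norm (x - z))) \<longlongrightarrow> ereal (\<epsilon> + K * norm (z - z))) (at z within \<Omega>)"
      by (intro tendsto_intros)
    then have "\<forall>\<^sub>F x in at z within \<Omega>. ereal (\<epsilon> + K * norm (x - z)) < y"
      by (rule order_tendstoD) (use that in simp)
    moreover have "\<forall>\<^sub>F x in at z within \<Omega>. x \<in> \<Omega> \<and> x \<noteq> z"
      by (auto simp: eventually_at_filter)
    ultimately show ?thesis
    proof eventually_elim
      case (elim x)
      then have "blinfun_apply zd (x - z) / norm (x - z) \<le> \<epsilon> + K * norm (x - z)"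
        using prox[of x] by (simp add: field_simps power2_eq_square)
      with elim(1) show ?case
        by (meson ereal_less_eq(3) le_less_trans)
    qed
  qed
  with \<open>z \<in> \<Omega>\<close> show ?thesis
    by (simp add: eps_normals_def Limsup_le_iff)
qed

lemma eps_normals_mono:
  assumes "\<epsilon> \<le> \<epsilon>'"
  shows "eps_normals \<epsilon> z \<Omega> \<subseteq> eps_normals \<epsilon>' z \<Omega>"
  using assms by (auto simp: eps_normals_def intro: order_trans)

text \<open>First-order expansion of the norm at \<open>e\<close>, with gradient
  \<open>sgn e\<close>. It comes from \<open>2ab \<le> a^2 + b^2\<close> for
  \<open>a = norm (e + h)\<close> and \<open>b = norm e\<close>, after expanding the square.\<close>

lemma norm_add_le_quadratic:
  fixes e h :: "'a::real_inner"
  assumes "e \<noteq> 0"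
  shows "norm (e + h) \<le> norm e + sgn e \<bullet> h + (norm h)\<^sup>2 / (2 * norm e)"
proof -
  have "2 * norm e * norm (e + h) \<le> (norm (e + h))\<^sup>2 + (norm e)\<^sup>2"
    using sum_squares_bound[of "norm (e + h)" "norm e"] by (simp add: ac_simps)
  also have "\<dots> = 2 * (norm e)\<^sup>2 + 2 * (e \<bullet> h) + (norm h)\<^sup>2"
    by (simp add: power2_norm_eq_inner inner_add_left inner_add_right inner_commute)
  also have "\<dots> = 2 * norm e * (norm e + sgn e \<bullet> h + (norm h)\<^sup>2 / (2 * norm e))"
    using assms by (simp add: sgn_div_norm field_simps power2_eq_square)
  finally show ?thesis
    using assms by (simp add: mult_le_cancel_left)
qed

text \<open>Expanding \<open>norm (y - r)\<close> around \<open>y - s\<close> turns the minimality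
  of \<open>s\<close> into a proximal inequality with tolerance 0.\<close>

lemma projection_frechet_normal:
  fixes y s :: "'a::real_inner"
  assumes "s \<in> \<Lambda>" "y \<noteq> s" and proj: "\<And>r. r \<in> \<Lambda> \<Longrightarrow> dist y s \<le> dist y r"
  shows "blinfun_inner_right (sgn (y - s)) \<in> frechet_normal_cone s \<Lambda>"
  unfolding frechet_normal_cone_def
proof (rule proximal_imp_eps_normals[where K = "1 / (2 * norm (y - s))"])
  fix r assume "r \<in> \<Lambda>"
  have "norm (y - s) \<le> norm ((y - s) + (s - r))"
    using proj[OF \<open>r \<in> \<Lambda>\<close>] by (simp add: dist_norm)
  also have "\<dots> \<le> norm (y - s) + sgn (y - s) \<bullet> (s - r) + (norm (s - r))\<^sup>2 / (2 * norm (y - s))"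
    by (rule norm_add_le_quadratic) (use \<open>y \<noteq> s\<close> in simp)
  finally show "blinfun_apply (blinfun_inner_right (sgn (y - s))) (r - s)
      \<le> 0 * norm (r - s) + 1 / (2 * norm (y - s)) * (norm (r - s))\<^sup>2"
    by (simp add: inner_diff_right norm_minus_commute)
qed fact

lemma dual_pair_zero_apply [simp]:
  "blinfun_apply (dual_pair 0 (- blinfun_inner_right y)) p = - (y \<bullet> snd p)"
  by (simp add: dual_pair_def blinfun.bilinear_simps)

text \<open>With \<open>s\<close> fixed, the norm is expanded in the increment
  \<open>P x' - P x\<close>. This and \<open>x' - x\<close> are the two components of an increment
  in the graph, so the penalty \<open>c\<close> becomes the tolerance and the remainder stays
  quadratic.\<close>

lemma graph_eps_normal:
  fixes P :: "'x::real_normed_vector \<Rightarrow> 'y::real_inner"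
  assumes "P x \<noteq> s" "c \<ge> 0"
    and min: "\<And>x'. norm (P x - s) \<le> norm (P x' - s) + c * dist x x'"
  shows "dual_pair 0 (- blinfun_inner_right (sgn (P x - s))) \<in> eps_normals c (x, P x) (gph P)"
proof (rule proximal_imp_eps_normals[where K = "1 / (2 * norm (P x - s))"])
  show "(x, P x) \<in> gph P"
    by (simp add: gph_def)
next
  fix p assume "p \<in> gph P"
  then obtain x' where p: "p = (x', P x')"
    by (auto simp: gph_def)
  have fst: "norm (x' - x) \<le> norm (p - (x, P x))"
    using norm_fst_le[of "x' - x" "P x' - P x"] by (simp add: p)
  have snd: "norm (P x' - P x) \<le> norm (p - (x, P x))"
    using norm_snd_le[of "P x' - P x" "x' - x"] by (simp add: p)
  have "norm (P x - s) \<le> norm ((P x - s) + (P x' - P x)) + c * norm (x' - x)"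
    using min[of x'] by (simp add: dist_norm norm_minus_commute)
  also have "norm ((P x - s) + (P x' - P x)) \<le> norm (P x - s) + sgn (P x - s) \<bullet> (P x' - P x)
      + (norm (P x' - P x))\<^sup>2 / (2 * norm (P x - s))"
    by (rule norm_add_le_quadratic) (use \<open>P x \<noteq> s\<close> in simp)
  finally have "- (sgn (P x - s) \<bullet> (P x' - P x))
      \<le> c * norm (x' - x) + (norm (P x' - P x))\<^sup>2 / (2 * norm (P x - s))"
    by simp
  also have "\<dots> \<le> c * norm (p - (x, P x)) + (norm (p - (x, P x)))\<^sup>2 / (2 * norm (P x - s))"
    by (intro add_mono mult_left_mono divide_right_mono power_mono fst snd) (use \<open>c \<ge> 0\<close> in auto)
  finally show "blinfun_apply (dual_pair 0 (- blinfun_inner_right (sgn (P x - s)))) (p - (x, P x))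
      \<le> c * norm (p - (x, P x)) + 1 / (2 * norm (P x - s)) * (norm (p - (x, P x)))\<^sup>2"
    by (simp add: p)
qed

text \<open>Ekeland's principle is applied to the residual \<open>infdist (P x) \<Lambda>\<close>
  with slope \<open>c\<close>. Its displacement bound and \<open>far\<close> exclude a feasible
  minimiser, so the projection direction is a unit vector.\<close>

lemma infeasible_normals:
  fixes P :: "'x::banach \<Rightarrow> 'y::euclidean_space"
  assumes cont: "continuous_on UNIV P" and "closed \<Lambda>" "\<Lambda> \<noteq> {}" and c: "c > 0"
    and far: "\<And>y. P y \<in> \<Lambda> \<Longrightarrow> infdist (P x0) \<Lambda> < c * dist x0 y"
  obtains x s where "s \<in> \<Lambda>" "P x \<noteq> s" "c * dist x0 x \<le> infdist (P x0) \<Lambda>"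
    "dist (P x) s \<le> infdist (P x0) \<Lambda>"
    "blinfun_inner_right (sgn (P x - s)) \<in> frechet_normal_cone s \<Lambda>"
    "dual_pair 0 (- blinfun_inner_right (sgn (P x - s))) \<in> eps_normals c (x, P x) (gph P)"
proof -
  let ?f = "\<lambda>x. infdist (P x) \<Lambda>"
  obtain x where x: "?f x + c * dist x0 x \<le> ?f x0"
      "\<And>z. z \<noteq> x \<Longrightarrow> ?f x < ?f z + c * dist x z"
  proof (rule ekeland_variational_principle[of ?f c x0])
    show "continuous_on UNIV ?f"
      by (intro continuous_on_infdist cont)
    show "bdd_below (range ?f)"
      by (rule bdd_belowI[of _ 0]) (auto simp: infdist_nonneg)
  qed (use c in auto)
  obtain s where s: "s \<in> \<Lambda>" "?f x = dist (P x) s"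
    using infdist_attains_inf[OF \<open>closed \<Lambda>\<close> \<open>\<Lambda> \<noteq> {}\<close>] by blast
  have near: "c * dist x0 x \<le> ?f x0"
    using x(1) infdist_nonneg[of "P x" \<Lambda>] by linarith
  have ne: "P x \<noteq> s"
    using far[of x] near s(1) by force
  show thesis
  proof (rule that[OF s(1) ne near])
    have "0 \<le> c * dist x0 x"
      using c by simp
    then show "dist (P x) s \<le> ?f x0"
      using x(1) s(2) by linarith
    show "blinfun_inner_right (sgn (P x - s)) \<in> frechet_normal_cone s \<Lambda>"
      by (rule projection_frechet_normal[OF s(1) ne]) (metis s(2) infdist_le)
    show "dual_pair 0 (- blinfun_inner_right (sgn (P x - s))) \<in> eps_normals c (x, P x) (gph P)"
    proof (rule graph_eps_normal[of P x s c, OF ne])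
      fix x'
      \<comment> \<open>The projection can be frozen: \<open>dist (P x') s\<close> majorises the
        residual at \<open>x'\<close>, with equality at \<open>x\<close>, so \<open>x\<close> also
        minimises the perturbed majorant.\<close>
      have "?f x \<le> ?f x' + c * dist x x'"
        using x(2)[of x'] by (cases "x' = x") auto
      moreover have "?f x' \<le> dist (P x') s"
        using s(1) by (rule infdist_le)
      ultimately show "norm (P x - s) \<le> norm (P x' - s) + c * dist x x'"
        using s(2) by (simp add: dist_norm)
    qed (use c in simp)
  qed
qed

section \<open>Sequences, limits and directional cones\<close>

text \<open>
  For \<open>u = 0\<close> the step sizes must be of larger order than \<open>norm (z k)\<close>.
\<close>

lemma dir_nbhd_scaling:
  assumes \<epsilon>: "\<epsilon> \<longlonglongrightarrow> 0" and z: "\<And>k. x + z k \<in> dir_nbhd (\<epsilon> k) (\<epsilon> k) x u" "\<And>k. z k \<noteq> 0"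
  obtains t where "decreases_to_zero t" "(\<lambda>k. z k /\<^sub>R t k) \<longlonglongrightarrow> u"
proof -
  have le: "norm (z k) \<le> \<epsilon> k"
    and dir: "norm (norm u *\<^sub>R z k - norm (z k) *\<^sub>R u) \<le> \<epsilon> k * norm (z k) * norm u" for k
    using z(1)[of k] by (auto simp: dir_nbhd_def)
  have lim: "(\<lambda>k. norm (z k)) \<longlonglongrightarrow> 0"
    by (rule tendsto_sandwich[OF _ _ tendsto_const \<epsilon>]) (use le in auto)
  show thesis
  proof (cases "u = 0")
    case True
    show thesis
    proof (rule that[of "\<lambda>k. sqrt (norm (z k))"])
      have sq: "(\<lambda>k. sqrt (norm (z k))) \<longlonglongrightarrow> 0"
        using tendsto_real_sqrt[OF lim] by simp
      then show "decreases_to_zero (\<lambda>k. sqrt (norm (z k)))"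
        using z(2) by (simp add: decreases_to_zero_def)
      have "norm (z k /\<^sub>R sqrt (norm (z k))) = sqrt (norm (z k))" for k
        by (simp add: real_div_sqrt flip: divide_inverse_commute)
      with sq show "(\<lambda>k. z k /\<^sub>R sqrt (norm (z k))) \<longlonglongrightarrow> u"
        unfolding True by (subst tendsto_norm_zero_iff[symmetric]) simp
    qed
  next
    case False
    \<comment> \<open>With this step size the quotient is \<open>z k\<close> rescaled to length
      \<open>norm u\<close>, and the neighbourhood inequality is exactly an estimate of its distance
      to \<open>u\<close>.\<close>
    show thesis
    proof (rule that[of "\<lambda>k. norm (z k) / norm u"])
      show "decreases_to_zero (\<lambda>k. norm (z k) / norm u)"
        using z(2) False tendsto_divide[OF lim tendsto_const[of "norm u"]]
        by (simp add: decreases_to_zero_def)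
      have bound: "norm (z k /\<^sub>R (norm (z k) / norm u) - u) \<le> \<epsilon> k * norm u" for k
      proof -
        have "z k /\<^sub>R (norm (z k) / norm u) - u
            = (norm u *\<^sub>R z k - norm (z k) *\<^sub>R u) /\<^sub>R norm (z k)"
          using z(2)[of k] by (simp add: scaleR_diff_right divide_simps)
        then have "norm (z k /\<^sub>R (norm (z k) / norm u) - u)
            = norm (norm u *\<^sub>R z k - norm (z k) *\<^sub>R u) / norm (z k)"
          by (simp only: norm_scaleR) (simp add: divide_inverse_commute)
        then show ?thesis
          using dir[of k] z(2)[of k] by (simp add: divide_le_eq ac_simps)
      qed
      have "(\<lambda>k. \<epsilon> k * norm u) \<longlonglongrightarrow> 0"
        using tendsto_mult_right[OF \<epsilon>, of "norm u"] by simp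
      then have "(\<lambda>k. z k /\<^sub>R (norm (z k) / norm u) - u) \<longlonglongrightarrow> 0"
        by (rule Lim_null_comparison[rotated]) (simp only: bound eventually_True)
      then show "(\<lambda>k. z k /\<^sub>R (norm (z k) / norm u)) \<longlonglongrightarrow> u"
        by (simp add: LIM_zero_iff)
    qed
  qed
qed

text \<open>Norm convergence implies weak* convergence. It suffices below, where the functionals
  come from convergent vectors of a finite-dimensional space.\<close>

lemma limitin_strong_operator_topologyI:
  "f \<longlonglongrightarrow> l \<Longrightarrow> limitin strong_operator_topology f l sequentially"
  using continuous_map_limit[OF strong_operator_topology_weaker_than_euclidean, of f l sequentially]
  by (simp add: o_def)

lemma decreases_to_zero_subseq:
  "decreases_to_zero t \<Longrightarrow> strict_mono r \<Longrightarrow> decreases_to_zero (t \<circ> r)"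
  by (auto simp: decreases_to_zero_def LIMSEQ_subseq_LIMSEQ)

lemma decreases_to_zero_inverse_Suc: "decreases_to_zero (\<lambda>k. 1 / real (Suc k))"
  unfolding decreases_to_zero_def using LIMSEQ_inverse_real_of_nat by (simp add: divide_inverse)

lemma hadamard_sequence:
  assumes "((\<lambda>(t, u'). (P (x + t *\<^sub>R u') - P x) /\<^sub>R t) \<longlongrightarrow> l) (at_right 0 \<times>\<^sub>F nhds u)"
    and "decreases_to_zero t" "us \<longlonglongrightarrow> u"
  shows "(\<lambda>k. (P (x + t k *\<^sub>R us k) - P x) /\<^sub>R t k) \<longlonglongrightarrow> l"
proof -
  have "filterlim t (at_right 0) sequentially"
    using assms(2) by (simp add: decreases_to_zero_def filterlim_at less_le)
  then have "filterlim (\<lambda>k. (t k, us k)) (at_right 0 \<times>\<^sub>F nhds u) sequentially"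
    using assms(3) by (rule filterlim_Pair)
  from filterlim_compose[OF assms(1) this] show ?thesis by simp
qed

lemma dir_limiting_normal_coneI:
  assumes "decreases_to_zero \<epsilon>" "decreases_to_zero t" "ws \<longlonglongrightarrow> w" "zds \<longlonglongrightarrow> zd"
    and "\<And>k. zds k \<in> eps_normals (\<epsilon> k) (z + t k *\<^sub>R ws k) \<Omega>"
  shows "zd \<in> dir_limiting_normal_cone z \<Omega> w"
proof -
  have "z + t k *\<^sub>R ws k \<in> \<Omega>" for k
    using assms(5)[of k] by (simp add: eps_normals_def)
  then show ?thesis
    unfolding dir_limiting_normal_cone_def
    using assms limitin_strong_operator_topologyI by blast
qed

lemma contingent_coneI:
  assumes t: "decreases_to_zero t" and "ws \<longlonglongrightarrow> w" "\<And>k. z + t k *\<^sub>R ws k \<in> \<Omega>"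
  shows "w \<in> contingent_cone z \<Omega>"
proof -
  have "((z + t k *\<^sub>R ws k) - z) /\<^sub>R t k = ws k" for k
    using t by (simp add: decreases_to_zero_def less_imp_neq[symmetric])
  with assms show ?thesis
    unfolding contingent_cone_def mem_Collect_eq
    by (intro exI[of _ t] exI[of _ "\<lambda>k. z + t k *\<^sub>R ws k"]) simp
qed

text \<open>By \<open>small\<close>, \<open>P\<close> and the projections \<open>s k\<close> have
  the same limiting difference quotient, the Hadamard derivative. Hence both families of normals
  pass to the limit along the same step sizes in compatible directions, and \<open>y\<close> is a
  forbidden multiplier.\<close>

lemma not_dir_quasi_normalityI:
  fixes P :: "'x::real_normed_vector \<Rightarrow> real ^ 'd"
  assumes had: "hadamard_dir_differentiable P x u"
    and t: "decreases_to_zero t" and us: "us \<longlonglongrightarrow> u"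
    and \<epsilon>: "decreases_to_zero \<epsilon>"
    and small: "(\<lambda>k. (P (x + t k *\<^sub>R us k) - s k) /\<^sub>R t k) \<longlonglongrightarrow> 0"
    and ne: "\<And>k. P (x + t k *\<^sub>R us k) \<noteq> s k"
    and normal: "\<And>k. blinfun_inner_right (sgn (P (x + t k *\<^sub>R us k) - s k))
      \<in> frechet_normal_cone (s k) \<Lambda>"
    and graph: "\<And>k. dual_pair 0 (- blinfun_inner_right (sgn (P (x + t k *\<^sub>R us k) - s k)))
      \<in> eps_normals (\<epsilon> k) (x + t k *\<^sub>R us k, P (x + t k *\<^sub>R us k)) (gph P)"
    and conv: "(\<lambda>k. sgn (P (x + t k *\<^sub>R us k) - s k)) \<longlonglongrightarrow> y"
  shows "\<not> dir_quasi_normality P \<Lambda> x u"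
proof -
  define p where "p k = P (x + t k *\<^sub>R us k)" for k
  define ys where "ys k = sgn (p k - s k)" for k
  have ys: "ys \<longlonglongrightarrow> y"
    using conv by (simp add: ys_def[abs_def] p_def)
  have tpos: "t k > 0" for k
    using t by (simp add: decreases_to_zero_def)
  obtain v where "((\<lambda>(t, u'). (P (x + t *\<^sub>R u') - P x) /\<^sub>R t) \<longlongrightarrow> v) (at_right 0 \<times>\<^sub>F nhds u)"
    using had by (auto simp: hadamard_dir_differentiable_def)
  from hadamard_sequence[OF this t us]
  have vs: "(\<lambda>k. (p k - P x) /\<^sub>R t k) \<longlonglongrightarrow> v"
    by (simp add: p_def)
  have ws: "(\<lambda>k. (s k - P x) /\<^sub>R t k) \<longlonglongrightarrow> v"
  proof -
    have "(\<lambda>k. (p k - P x) /\<^sub>R t k - (p k - s k) /\<^sub>R t k) \<longlonglongrightarrow> v - 0"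
      using vs small by (intro tendsto_diff) (simp_all add: p_def)
    then show ?thesis
      by (simp flip: scaleR_diff_right)
  qed
  have s_eq: "P x + t k *\<^sub>R ((s k - P x) /\<^sub>R t k) = s k" for k
    using tpos[of k] by simp
  have p_eq: "(x, P x) + t k *\<^sub>R (us k, (p k - P x) /\<^sub>R t k) = (x + t k *\<^sub>R us k, p k)" for k
    using tpos[of k] by simp
  have pair: "(\<lambda>k. (us k, (p k - P x) /\<^sub>R t k)) \<longlonglongrightarrow> (u, v)"
    by (intro tendsto_Pair us vs)
  have inS: "s k \<in> \<Lambda>" for k
    using normal[of k] by (simp add: frechet_normal_cone_def eps_normals_def)
  have "v \<in> graphical_derivative P x u"
    unfolding graphical_derivative_def mem_Collect_eq
    by (rule contingent_coneI[OF t pair], subst p_eq) (simp add: gph_def p_def)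
  moreover have "v \<in> contingent_cone (P x) \<Lambda>"
    by (rule contingent_coneI[OF t ws]) (simp only: s_eq inS)
  moreover have "y \<noteq> 0"
  proof -
    have "norm (ys k) = 1" for k
      using ne[of k] by (simp add: ys_def p_def norm_sgn)
    with tendsto_norm[OF ys] have "norm y = 1"
      by (simp add: LIMSEQ_const_iff)
    then show ?thesis by auto
  qed
  moreover have lin: "(\<lambda>k. blinfun_inner_right (ys k)) \<longlonglongrightarrow> blinfun_inner_right y"
    by (rule bounded_linear.tendsto[OF bounded_linear_blinfun_inner_right ys])
  moreover have "0 \<in> dir_coderivative P x (u, v) (blinfun_inner_right y)"
    unfolding dir_coderivative_def mem_Collect_eq
  proof (rule dir_limiting_normal_coneI[OF \<epsilon> t pair])
    show "(\<lambda>k. dual_pair 0 (- blinfun_inner_right (ys k))) \<longlonglongrightarrow>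
        dual_pair 0 (- blinfun_inner_right y)"
      unfolding dual_pair_def
      by (intro tendsto_intros lin bounded_bilinear.tendsto[OF bounded_bilinear_blinfun_compose])
    show "dual_pair 0 (- blinfun_inner_right (ys k))
        \<in> eps_normals (\<epsilon> k) ((x, P x) + t k *\<^sub>R (us k, (p k - P x) /\<^sub>R t k)) (gph P)" for k
      unfolding p_eq unfolding ys_def p_def by (rule graph)
  qed
  moreover have "blinfun_inner_right y \<in> dir_limiting_normal_cone (P x) \<Lambda> v"
  proof (rule dir_limiting_normal_coneI[OF \<epsilon> t ws lin])
    fix k
    have "blinfun_inner_right (ys k) \<in> eps_normals 0 (s k) \<Lambda>"
      using normal[of k] by (simp add: frechet_normal_cone_def ys_def p_def)
    moreover have "0 \<le> \<epsilon> k"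
      using \<epsilon> by (simp add: decreases_to_zero_def less_imp_le)
    ultimately show "blinfun_inner_right (ys k)
        \<in> eps_normals (\<epsilon> k) (P x + t k *\<^sub>R ((s k - P x) /\<^sub>R t k)) \<Lambda>"
      unfolding s_eq using eps_normals_mono by blast
  qed
  moreover have "s \<longlonglongrightarrow> P x"
  proof -
    have "(\<lambda>k. P x + t k *\<^sub>R ((s k - P x) /\<^sub>R t k)) \<longlonglongrightarrow> P x + 0 *\<^sub>R v"
      by (intro tendsto_intros ws) (use t in \<open>simp add: decreases_to_zero_def\<close>)
    then show ?thesis
      unfolding s_eq by simp
  qed
  \<comment> \<open>\<open>p k - s k\<close> is a positive multiple of \<open>ys k\<close>, which
    tends to \<open>y\<close>; so the signs agree eventually in each nonzero coordinate of
    \<open>y\<close>, and there are finitely many coordinates.\<close>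
  moreover have "\<forall>\<^sub>F k in sequentially. \<forall>i. y $ i \<noteq> 0 \<longrightarrow> y $ i * (p k - s k) $ i > 0"
  proof (rule eventually_all_finite)
    fix i
    show "\<forall>\<^sub>F k in sequentially. y $ i \<noteq> 0 \<longrightarrow> y $ i * (p k - s k) $ i > 0"
    proof (cases "y $ i = 0")
      case False
      have "(\<lambda>k. y $ i * ys k $ i) \<longlonglongrightarrow> y $ i * y $ i"
        by (intro tendsto_intros ys)
      then have "\<forall>\<^sub>F k in sequentially. y $ i * ys k $ i > 0"
        by (rule order_tendstoD) (use False in \<open>auto simp: zero_less_mult_iff\<close>)
      then show ?thesis
      proof eventually_elim
        case (elim k)
        have "norm (p k - s k) > 0"
          using ne[of k] by (simp add: p_def)
        moreover from this have "p k - s k = norm (p k - s k) *\<^sub>R ys k"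
          by (simp add: ys_def sgn_div_norm)
        then have "y $ i * (p k - s k) $ i = norm (p k - s k) * (y $ i * ys k $ i)"
          by (metis vector_scaleR_component mult.left_commute real_scaleR_def)
        ultimately show ?case
          using elim by (simp only: mult_pos_pos simp_thms)
      qed
    qed simp
  qed
  moreover have "blinfun_inner_right (ys k) \<in> frechet_normal_cone (s k) \<Lambda>" for k
    using normal[of k] by (simp add: ys_def p_def)
  ultimately show ?thesis
    unfolding dir_quasi_normality_def p_def using t us ys by blast
qed

section \<open>From failure of subregularity to a forbidden multiplier\<close>

text \<open>Passes from the extended-real residual to a real one. For empty \<open>\<Lambda>\<close>
  the left side is 0 and the right side is infinite.\<close>

lemma infdist_le_set_dist:
  "ereal (infdist y \<Lambda>) \<le> set_dist 0 {y - s | s. s \<in> \<Lambda>}"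
  unfolding set_dist_def
  by (rule INF_greatest) (auto simp: dist_commute simp flip: dist_norm intro: infdist_le2)

theorem corollary4p10:
  fixes P :: "'x::banach \<Rightarrow> real ^ 'd" and \<Lambda> :: "(real ^ 'd) set" and xbar u :: 'x
  assumes "asplund_space TYPE('x)"
    and "continuous_on UNIV P"
    and "closed \<Lambda>"
    and "P xbar \<in> \<Lambda>"
    and "hadamard_dir_differentiable P xbar u"
    and "dir_quasi_normality P \<Lambda> xbar u"
  shows "dir_metrically_subregular (\<lambda>x. {P x - s | s. s \<in> \<Lambda>}) xbar 0 u"
proof (rule ccontr)
  assume not_subregular: "\<not> ?thesis"
  define c where "c k = 1 / real (Suc k)" for k
  have c: "decreases_to_zero c"
    using decreases_to_zero_inverse_Suc by (simp add: c_def[abs_def])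
  have cpos: "c k > 0" and cle: "c k \<le> 1" for k
    by (simp_all add: c_def)
  have "\<exists>x. x \<in> dir_nbhd (c k) (c k) xbar u \<and>
      (\<forall>y. P y \<in> \<Lambda> \<longrightarrow> infdist (P x) \<Lambda> < (c k)\<^sup>2 * dist x y)" for k
  proof -
    \<comment> \<open>The square provides two small factors: one becomes the slope in Ekeland's
      principle, the other makes the displacement negligible against
      \<open>norm (z k)\<close>.\<close>
    let ?\<kappa> = "1 / (c k)\<^sup>2"
    have "?\<kappa> > 0"
      using cpos[of k] by simp
    moreover have "0 \<in> {P xbar - s |s. s \<in> \<Lambda>}"
      using \<open>P xbar \<in> \<Lambda>\<close> by auto
    ultimately obtain x where x: "x \<in> dir_nbhd (c k) (c k) xbar u"
        "\<not> set_dist x {x'. 0 \<in> {P x' - s |s. s \<in> \<Lambda>}}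
          \<le> ereal ?\<kappa> * set_dist 0 {P x - s |s. s \<in> \<Lambda>}"
      using not_subregular cpos[of k] unfolding dir_metrically_subregular_def by blast
    have "infdist (P x) \<Lambda> < (c k)\<^sup>2 * dist x y" if "P y \<in> \<Lambda>" for y
    proof -
      have "ereal (?\<kappa> * infdist (P x) \<Lambda>) \<le> ereal ?\<kappa> * set_dist 0 {P x - s |s. s \<in> \<Lambda>}"
        using ereal_mult_left_mono[OF infdist_le_set_dist, of "ereal ?\<kappa>" "P x" \<Lambda>] by simp
      also have "\<dots> < set_dist x {x'. 0 \<in> {P x' - s |s. s \<in> \<Lambda>}}"
        using x(2) by simp
      also have "\<dots> \<le> ereal (dist x y)"
        unfolding set_dist_def dist_norm by (rule INF_lower) (use that in auto)
      finally show ?thesis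
        using cpos[of k] by (simp add: field_simps)
    qed
    with x(1) show ?thesis by blast
  qed
  then obtain x where nbhd: "\<And>k. x k \<in> dir_nbhd (c k) (c k) xbar u"
    and far: "\<And>k y. P y \<in> \<Lambda> \<Longrightarrow> infdist (P (x k)) \<Lambda> < (c k)\<^sup>2 * dist (x k) y"
    by metis
  define z where "z k = x k - xbar" for k
  \<comment> \<open>The reference point \<open>xbar\<close> is itself feasible, so it can serve as
    \<open>y\<close> in \<open>far\<close>. The strict inequality also forces
    \<open>z k \<noteq> 0\<close>.\<close>
  have gap: "infdist (P (x k)) \<Lambda> < (c k)\<^sup>2 * norm (z k)" for k
    using far[OF \<open>P xbar \<in> \<Lambda>\<close>] by (simp add: z_def dist_norm)
  have "z k \<noteq> 0" for k
    using gap[of k] infdist_nonneg[of "P (x k)" \<Lambda>] by auto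
  then obtain t where t: "decreases_to_zero t" "(\<lambda>k. z k /\<^sub>R t k) \<longlonglongrightarrow> u"
    using dir_nbhd_scaling[of c xbar z u] c nbhd by (auto simp: decreases_to_zero_def z_def)
  have tpos: "t k > 0" for k
    using t(1) by (simp add: decreases_to_zero_def)
  have sq: "(c k)\<^sup>2 * a \<le> c k * a" if "a \<ge> 0" for a k
    using that cpos[of k] cle[of k]
    by (intro mult_right_mono) (simp_all add: power2_eq_square mult_left_le)
  have "\<exists>x' s. P x' \<noteq> s \<and> c k * dist (x k) x' \<le> infdist (P (x k)) \<Lambda> \<and>
      dist (P x') s \<le> infdist (P (x k)) \<Lambda> \<and>
      blinfun_inner_right (sgn (P x' - s)) \<in> frechet_normal_cone s \<Lambda> \<and>
      dual_pair 0 (- blinfun_inner_right (sgn (P x' - s))) \<in> eps_normals (c k) (x', P x') (gph P)"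
    for k
  proof (rule infeasible_normals[OF assms(2,3) _ cpos[of k]])
    show "infdist (P (x k)) \<Lambda> < c k * dist (x k) y" if "P y \<in> \<Lambda>" for y
      using far[OF that, of k] sq[of "dist (x k) y" k] by simp
  qed (use assms(4) in blast)+
  then obtain x' s where ne: "\<And>k. P (x' k) \<noteq> s k"
    and near: "\<And>k. c k * dist (x k) (x' k) \<le> infdist (P (x k)) \<Lambda>"
    and dist_s: "\<And>k. dist (P (x' k)) (s k) \<le> infdist (P (x k)) \<Lambda>"
    and normal: "\<And>k. blinfun_inner_right (sgn (P (x' k) - s k)) \<in> frechet_normal_cone (s k) \<Lambda>"
    and graph: "\<And>k. dual_pair 0 (- blinfun_inner_right (sgn (P (x' k) - s k)))
      \<in> eps_normals (c k) (x' k, P (x' k)) (gph P)"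
    by metis
  have bound: "(\<lambda>k. c k * norm (z k /\<^sub>R t k)) \<longlonglongrightarrow> 0"
    using tendsto_mult[OF _ tendsto_norm[OF t(2)], of c 0] c by (simp add: decreases_to_zero_def)
  \<comment> \<open>One factor \<open>c k\<close> cancels against the slope, the other
    remains.\<close>
  have near': "norm (x' k - x k) \<le> c k * norm (z k)" for k
  proof -
    have "c k * norm (x' k - x k) < c k * (c k * norm (z k))"
      using near[of k] gap[of k]
      by (simp add: dist_norm norm_minus_commute power2_eq_square mult.assoc)
    then show ?thesis
      using cpos[of k] by simp
  qed
  have dist_s': "norm (P (x' k) - s k) \<le> c k * norm (z k)" for k
    using dist_s[of k] gap[of k] sq[of "norm (z k)" k] by (simp add: dist_norm)
  \<comment> \<open>\<open>z k /\<^sub>R t k\<close> converges, so anything dominated by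
    \<open>c k * norm (z k)\<close> is of smaller order than \<open>t k\<close>. This serves both
    the Ekeland displacement and the residual.\<close>
  have scaled: "(\<lambda>k. a k /\<^sub>R t k) \<longlonglongrightarrow> 0" if "\<And>k. norm (a k) \<le> c k * norm (z k)"
    for a :: "nat \<Rightarrow> 'b::real_normed_vector"
  proof (rule Lim_null_comparison[OF always_eventually bound], rule allI)
    fix k
    show "norm (a k /\<^sub>R t k) \<le> c k * norm (z k /\<^sub>R t k)"
      using mult_left_mono[OF that[of k], of "inverse (t k)"] tpos[of k] by (simp add: ac_simps)
  qed
  define us where "us k = (x' k - xbar) /\<^sub>R t k" for k
  have us: "us \<longlonglongrightarrow> u"
  proof -
    have "(\<lambda>k. z k /\<^sub>R t k + (x' k - x k) /\<^sub>R t k) \<longlonglongrightarrow> u + 0"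
      by (intro tendsto_add t(2) scaled near')
    then show ?thesis
      by (simp add: us_def[abs_def] z_def flip: scaleR_add_right)
  qed
  have x'_eq: "xbar + t k *\<^sub>R us k = x' k" for k
    using tpos[of k] by (simp add: us_def)
  have "norm (sgn (P (x' k) - s k)) = 1" for k
    using ne[of k] by (simp add: norm_sgn)
  then have "\<forall>k. sgn (P (x' k) - s k) \<in> sphere 0 1"
    by simp
  \<comment> \<open>Compactness of the unit sphere of \<open>real ^ 'd\<close> gives the multiplier;
    all the sequences are then restricted to \<open>r\<close>.\<close>
  then obtain y r where r: "strict_mono (r :: nat \<Rightarrow> nat)"
      "((\<lambda>k. sgn (P (x' k) - s k)) \<circ> r) \<longlonglongrightarrow> y"
    using compact_sphere[of "0 :: real ^ 'd" 1] unfolding compact_def by meson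
  have "\<not> dir_quasi_normality P \<Lambda> xbar u"
  proof (rule not_dir_quasi_normalityI[where t = "t \<circ> r" and us = "us \<circ> r" and s = "s \<circ> r"
        and \<epsilon> = "c \<circ> r" and y = y])
    show "(\<lambda>k. (P (xbar + (t \<circ> r) k *\<^sub>R (us \<circ> r) k) - (s \<circ> r) k) /\<^sub>R (t \<circ> r) k) \<longlonglongrightarrow> 0"
      using LIMSEQ_subseq_LIMSEQ[OF scaled[OF dist_s'] r(1)] by (simp add: x'_eq o_def)
  qed (use assms(5) r ne normal graph in \<open>simp_all add: x'_eq o_def
        decreases_to_zero_subseq[OF t(1) r(1), unfolded o_def]
        decreases_to_zero_subseq[OF c r(1), unfolded o_def]
        LIMSEQ_subseq_LIMSEQ[OF us r(1), unfolded o_def]\<close>)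
  with assms(6) show False by simp
qed

end
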